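(* Let $0<\alpha<1$ and $0<\eta<1-\alpha^2$. Then there exists a positive constant $B$, depending only on $\alpha$ and $\eta$, such that for every positive integer $m$, writing $q=2^m$ and letting $f$ be a uniformly random function from $V_m=\mathbb{F}_2^m$ to $\{\pm1\}$, $$P\Big(\|\widehat f\|_\infty> \Big(\frac{\alpha}{2}-\frac{\eta}{\alpha}-\alpha^3\frac{\log q}{q}\Big)\sqrt{q\log q}\Big)>1-\frac{B}{q^\eta}.$$
   Context: $\Omega_m$ is the finite set of all functions $f:V_m\to\{\pm1\}$, equipped with the uniform probability $P$ (each $f$ has probability $2^{-q}$). A character $\chi$ of $V_m$ is a group homomorphism $V_m\to\{\pm1\}$; $\widehat V_m$ is the set of characters. The Fourier transform of $f$ is $\widehat f(\chi)=\sum_{x\in V_m}f(x)\chi(x)$, and $\|\widehat f\|_\infty=\max_{\chi\in\widehat V_m}|\widehat f(\chi)|$. $\log$ is the natural logarithm. *)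

theory Defs
  imports
    "HOL-Probability.Probability_Mass_Function"
    "HOL-Library.Z2"
    "HOL-Algebra.Group"
    "Jordan_Normal_Form.Matrix"
begin

text \<open>The group \<open>V\<^sub>m = \<F>\<^sub>2\<^sup>m\<close>: vectors of length \<open>m\<close> over the two-element field \<^typ>\<open>bit\<close>.\<close>

definition V_group :: "nat \<Rightarrow> bit Matrix.vec monoid" where
  "V_group m = monoid_vec TYPE(bit) m"

definition V :: "nat \<Rightarrow> bit Matrix.vec set" where
  "V m = carrier (V_group m)"

definition sign_group :: "real monoid" where
  "sign_group = \<lparr>carrier = {-1, 1}, mult = (*), one = 1\<rparr>"

text \<open>Functions on \<open>V\<^sub>m\<close> are taken extensional (equal to \<^const>\<open>undefined\<close> off \<open>V\<^sub>m\<close>),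
  so that distinct elements of the two sets below are distinct as functions on \<open>V\<^sub>m\<close>.\<close>

definition Omega :: "nat \<Rightarrow> (bit Matrix.vec \<Rightarrow> real) set" where
  "Omega m = V m \<rightarrow>\<^sub>E {-1, 1}"

definition characters :: "nat \<Rightarrow> (bit Matrix.vec \<Rightarrow> real) set" where
  "characters m = hom (V_group m) sign_group \<inter> extensional (V m)"

definition fourier :: "nat \<Rightarrow> (bit Matrix.vec \<Rightarrow> real) \<Rightarrow> (bit Matrix.vec \<Rightarrow> real) \<Rightarrow> real" where
  "fourier m f \<phi> = (\<Sum>x\<in>V m. f x * \<phi> x)"

definition fourier_sup_norm :: "nat \<Rightarrow> (bit Matrix.vec \<Rightarrow> real) \<Rightarrow> real" where
  "fourier_sup_norm m f = Max ((\<lambda>\<phi>. \<bar>fourier m f \<phi>\<bar>) ` characters m)"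

definition prob_Omega :: "nat \<Rightarrow> (bit Matrix.vec \<Rightarrow> real) set \<Rightarrow> real" where
  "prob_Omega m A = measure_pmf.prob (pmf_of_set (Omega m)) A"

text \<open>The sums, maxima and uniform distributions above range over finite nonempty sets.\<close>

lemma V_eq: "V m = carrier_vec m"
  by (simp only: V_def V_group_def monoid_vec_simps)

lemma bij_betw_V: "bij_betw (\<lambda>g. Matrix.vec m g) ({..<m} \<rightarrow>\<^sub>E (UNIV :: bit set)) (V m)"
proof (rule bij_betw_byWitness[where f' = "\<lambda>v. restrict (vec_index v) {..<m}"])
  show "\<forall>g\<in>{..<m} \<rightarrow>\<^sub>E (UNIV :: bit set). restrict (vec_index (Matrix.vec m g)) {..<m} = g"
  proof
    fix g :: "nat \<Rightarrow> bit" assume g: "g \<in> {..<m} \<rightarrow>\<^sub>E UNIV"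
    show "restrict (vec_index (Matrix.vec m g)) {..<m} = g"
    proof
      fix i show "restrict (vec_index (Matrix.vec m g)) {..<m} i = g i"
        using PiE_arb[OF g, of i] by (cases "i < m") (simp_all only: restrict_apply index_vec
          lessThan_iff if_True if_False not_False_eq_True)
    qed
  qed
  show "\<forall>v\<in>V m. Matrix.vec m (restrict (vec_index v) {..<m}) = v"
  proof
    fix v assume "v \<in> V m"
    then have "dim_vec v = m" unfolding V_eq by (rule carrier_vecD)
    then show "Matrix.vec m (restrict (vec_index v) {..<m}) = v"
      by (intro eq_vecI) (simp_all only: dim_vec index_vec restrict_apply lessThan_iff if_True)
  qed
  show "(\<lambda>g. Matrix.vec m g) ` ({..<m} \<rightarrow>\<^sub>E (UNIV :: bit set)) \<subseteq> V m"
    unfolding V_eq by (rule image_subsetI) (rule vec_carrier)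
  show "(\<lambda>v. restrict (vec_index v) {..<m}) ` V m \<subseteq> {..<m} \<rightarrow>\<^sub>E (UNIV :: bit set)"
    by (rule image_subsetI) (rule restrict_PiE_iff[THEN iffD2], rule ballI, rule UNIV_I)
qed

lemma card_V: "card (V m) = 2 ^ m"
proof -
  have "(UNIV :: bit set) = {0, 1}"
    using bit.exhaust by blast
  moreover have "card {0, 1 :: bit} = 2"
    by simp
  ultimately have UNIV_card: "card (UNIV :: bit set) = 2"
    by (rule ssubst)
  have "card (V m) = card ({..<m} \<rightarrow>\<^sub>E (UNIV :: bit set))"
    by (rule bij_betw_same_card[OF bij_betw_V, symmetric])
  also have "\<dots> = (\<Prod>i<m. card (UNIV :: bit set))"
    by (rule card_PiE) (rule finite_lessThan)
  also have "\<dots> = 2 ^ m"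
    unfolding UNIV_card by simp
  finally show ?thesis .
qed

lemma finite_V: "finite (V m)"
  by (rule card_ge_0_finite) (simp add: card_V)

lemma finite_Omega: "finite (Omega m)"
  unfolding Omega_def by (intro finite_PiE finite_V) simp

lemma card_Omega: "card (Omega m) = 2 ^ 2 ^ m"
proof -
  have "card {-1, 1 :: real} = 2"
    by simp
  then show ?thesis
    by (simp only: Omega_def card_PiE[OF finite_V] prod_constant card_V)
qed

lemma Omega_nonempty: "Omega m \<noteq> {}"
  unfolding Omega_def by (simp add: PiE_eq_empty_iff)

lemma finite_characters: "finite (characters m)"
proof (rule finite_subset)
  show "characters m \<subseteq> Omega m"
    unfolding characters_def Omega_def hom_def sign_group_def V_def PiE_def by auto
qed (rule finite_Omega)

lemma characters_nonempty: "characters m \<noteq> {}"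
proof -
  have "(\<lambda>x\<in>V m. 1) \<in> characters m"
    by (auto simp: characters_def hom_def sign_group_def V_def V_group_def monoid_vec_def)
  then show ?thesis by blast
qed

lemma prob_Omega_eq_card:
  "prob_Omega m {f. Q f} = card {f \<in> Omega m. Q f} / card (Omega m)"
proof -
  have "Omega m \<inter> {f. Q f} = {f \<in> Omega m. Q f}"
    by blast
  then show ?thesis
    by (simp add: prob_Omega_def measure_pmf_of_set finite_Omega Omega_nonempty)
qed

end

theory Submission
  imports Defs
begin

text \<open>Let \<open>X f = (\<Sum>\<phi>. exp (t * fourier m f \<phi>))\<close> with \<open>t = \<alpha> * sqrt (ln q / q)\<close>. The summands
  for distinct characters are non-positively correlated, because \<open>\<phi> \<psi>\<close> is then a nontrivial
  character and sums to zero; hence Chebyshev's inequality gives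
  \<open>X f > q powr - \<eta> * E X\<close> outside a set of probability \<open>O(q powr (\<alpha>\<^sup>2 - 1))\<close>. On the other
  hand \<open>X f\<close> is at most the number of characters times \<open>exp (t * fourier_sup_norm m f)\<close>, and
  taking logarithms yields the lower bound on the sup norm.\<close>

section \<open>Bounds on the hyperbolic cosine\<close>

text \<open>Compares the Taylor coefficients of \<open>cosh x\<close> with those of
  \<open>exp (x^2 / 2)\<close>.\<close>

lemma fact_double_ge: "2 ^ n * fact n \<le> (fact (2 * n) :: real)"
proof (induction n)
  case (Suc n)
  have "2 ^ Suc n * fact (Suc n) = (2 * (real n + 1)) * (2 ^ n * fact n :: real)"
    by simp
  also have "\<dots> \<le> ((2 * real n + 2) * (2 * real n + 1)) * fact (2 * n)"
    by (intro mult_mono Suc.IH) (auto intro: order.trans[OF _ mult_left_mono[of 1]])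
  also have "\<dots> = fact (2 * Suc n)"
    by (simp add: algebra_simps)
  finally show ?case .
qed simp

lemma cosh_sums_even: "(\<lambda>n. x ^ (2 * n) / fact (2 * n)) sums cosh (x :: real)"
proof -
  have "(\<lambda>n. if even (2 * n) then x ^ (2 * n) /\<^sub>R fact (2 * n) else 0) sums cosh x"
    by (subst sums_mono_reindex[where g = "\<lambda>n. 2 * n" and f = "\<lambda>n. if even n then x ^ n /\<^sub>R fact n else 0"])
      (auto simp: strict_mono_def cosh_converges elim!: evenE)
  then show ?thesis
    by (simp add: field_simps)
qed

lemma cosh_le_exp_half_square: "cosh (x :: real) \<le> exp (x\<^sup>2 / 2)"
proof (rule sums_le)
  show "(\<lambda>n. x ^ (2 * n) / fact (2 * n)) sums cosh x"
    by (rule cosh_sums_even)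
  show "(\<lambda>n. (x\<^sup>2 / 2) ^ n /\<^sub>R fact n) sums exp (x\<^sup>2 / 2)"
    by (rule exp_converges)
  fix n
  have eq: "(y / 2) ^ n /\<^sub>R fact n = y ^ n / (2 ^ n * fact n)" for y :: real
    by (simp add: power_divide field_simps)
  show "x ^ (2 * n) / fact (2 * n) \<le> (x\<^sup>2 / 2) ^ n /\<^sub>R fact n"
    unfolding eq power_mult[of x 2 n] by (intro divide_left_mono fact_double_ge) auto
qed

text \<open>Truncation of the even power series, whose terms are all nonnegative.\<close>

lemma one_plus_half_square_le_cosh: "1 + x\<^sup>2 / 2 \<le> cosh (x :: real)"
proof -
  have "(\<Sum>n<2. x ^ (2 * n) / fact (2 * n)) \<le> (\<Sum>n. x ^ (2 * n) / fact (2 * n))"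
    by (intro sum_le_suminf) (auto intro: sums_summable[OF cosh_sums_even])
  then show ?thesis
    using sums_unique[OF cosh_sums_even[of x]] by (simp add: numeral_2_eq_2)
qed

text \<open>Follows from \<open>ln (1 + u) \<ge> u - u^2\<close> with \<open>u = x^2 / 2\<close>.
  The error \<open>x ^ 4\<close> is the origin of the \<open>\<alpha> ^ 3 * (ln q / q)\<close> term
  in the theorem.\<close>

lemma exp_le_cosh: "exp (x\<^sup>2 / 2 - x ^ 4) \<le> cosh (x :: real)"
proof -
  let ?u = "x\<^sup>2 / 2"
  have "?u - ?u\<^sup>2 \<le> ln (1 + ?u)"
  proof (cases "?u \<le> 1")
    case True
    then show ?thesis by (intro ln_one_plus_pos_lower_bound) auto
  next
    \<comment> \<open>For \<open>u > 1\<close> the left side is negative, while the logarithm is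
      nonnegative.\<close>
    case False
    then have "?u * 1 \<le> ?u * ?u" by (intro mult_left_mono) auto
    moreover have "0 \<le> ln (1 + ?u)" by simp
    ultimately show ?thesis unfolding power2_eq_square by linarith
  qed
  moreover have "?u\<^sup>2 \<le> x ^ 4"
    by (simp add: power_divide)
  ultimately have "exp (?u - x ^ 4) \<le> exp (ln (1 + ?u))"
    by simp
  also have "\<dots> = 1 + ?u"
    by (rule exp_ln) (simp add: add_pos_nonneg)
  also have "\<dots> \<le> cosh x"
    by (rule one_plus_half_square_le_cosh)
  finally show ?thesis .
qed

text \<open>An exact identity for signs followed by \<open>1 + y \<le> exp y\<close>. The
  exponential form turns a product over \<open>x\<close> into the exponential of a sum of
  \<open>a * b\<close>, which orthogonality of characters makes vanish.\<close>

lemma cosh_add_sign_le: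
  fixes t a b :: real
  assumes "a \<in> {-1, 1}" "b \<in> {-1, 1}"
  shows "cosh (t * (a + b)) \<le> (cosh t)\<^sup>2 * exp (a * b * (tanh t)\<^sup>2)"
proof -
  have "cosh (t * (a + b)) = (cosh t)\<^sup>2 + a * b * (sinh t)\<^sup>2"
    using assms by (auto simp: distrib_left cosh_add power2_eq_square cosh_square_eq[unfolded power2_eq_square])
  also have "\<dots> = (cosh t)\<^sup>2 * (1 + a * b * (tanh t)\<^sup>2)"
    by (simp add: tanh_def field_simps)
  also have "\<dots> \<le> (cosh t)\<^sup>2 * exp (a * b * (tanh t)\<^sup>2)"
    by (intro mult_left_mono exp_ge_add_one_self) auto
  finally show ?thesis .
qed

text \<open>Bound for a character paired with itself: equal signs give
  \<open>cosh (2 * t) = 2 * (cosh t)^2 - 1\<close>, and \<open>((cosh t)^2 - 1)^2 \<ge> 0\<close>;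
  opposite signs give \<open>cosh 0 = 1\<close>.\<close>

lemma cosh_add_sign_le':
  fixes t a b :: real
  assumes "a \<in> {-1, 1}" "b \<in> {-1, 1}"
  shows "cosh (t * (a + b)) \<le> cosh t ^ 4"
proof -
  have c: "1 \<le> cosh t ^ 4" by (simp add: cosh_real_ge_1)
  have "0 \<le> ((cosh t)\<^sup>2 - 1)\<^sup>2" by simp
  also have "\<dots> = cosh t ^ 4 - (2 * (cosh t)\<^sup>2 - 1)"
    by (simp add: power2_eq_square power4_eq_xxxx algebra_simps)
  also have "2 * (cosh t)\<^sup>2 - 1 = cosh (2 * t)"
    using cosh_square_eq[of t] by (simp add: cosh_double)
  finally show ?thesis
    using assms c by (auto simp: mult.commute)
qed

section \<open>Exponential sums over all sign functions\<close>

text \<open>The values of \<open>f\<close> are independent signs, so the sum factorises over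
  \<open>V m\<close>, each factor being \<open>exp (t * a x) + exp (- t * a x)\<close>.\<close>

lemma sum_Omega_exp:
  "(\<Sum>f\<in>Omega m. exp (t * (\<Sum>x\<in>V m. f x * a x))) = 2 ^ 2 ^ m * (\<Prod>x\<in>V m. cosh (t * a x))"
proof -
  have "(\<Sum>f\<in>Omega m. exp (t * (\<Sum>x\<in>V m. f x * a x)))
      = (\<Sum>f\<in>V m \<rightarrow>\<^sub>E {-1, 1}. \<Prod>x\<in>V m. exp (t * (f x * a x)))"
    by (simp add: Omega_def sum_distrib_left exp_sum finite_V)
  also have "\<dots> = (\<Prod>x\<in>V m. \<Sum>y\<in>{-1, 1}. exp (t * (y * a x)))"
    by (rule prod_sum_PiE[symmetric]) (simp_all add: finite_V)
  also have "\<dots> = (\<Prod>x\<in>V m. 2 * cosh (t * a x))"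
    by (intro prod.cong refl) (simp add: cosh_def)
  also have "\<dots> = 2 ^ 2 ^ m * (\<Prod>x\<in>V m. cosh (t * a x))"
    by (simp add: prod.distrib card_V)
  finally show ?thesis .
qed

section \<open>Number and orthogonality of characters\<close>

lemma characters_iff:
  "\<phi> \<in> characters m \<longleftrightarrow> \<phi> \<in> V m \<rightarrow>\<^sub>E {-1, 1} \<and>
    (\<forall>x\<in>V m. \<forall>y\<in>V m. \<phi> (x + y) = \<phi> x * \<phi> y)"
  by (auto simp: characters_def hom_def sign_group_def V_def V_group_def monoid_vec_def
      PiE_def)

lemma character_sign: "\<phi> \<in> characters m \<Longrightarrow> x \<in> V m \<Longrightarrow> \<phi> x \<in> {-1, 1}"
  unfolding characters_iff by blast

text \<open>Each subset \<open>A\<close> of the coordinates gives the Walsh character that maps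
  \<open>x\<close> to -1 to the power of the sum of its entries over \<open>A\<close>; distinct
  subsets give distinct characters.\<close>

lemma card_characters_ge: "2 ^ m \<le> card (characters m)"
proof -
  define \<phi> where "\<phi> A = (\<lambda>x\<in>V m. \<Prod>i\<in>A. if vec_index x i = 1 then - 1 else (1::real))" for A
  have "\<phi> A \<in> characters m" if A: "A \<subseteq> {..<m}" for A
  proof -
    have "(\<Prod>i\<in>A. if vec_index x i = (1::bit) then - 1 else 1) \<in> {- 1, 1 :: real}" for x
      by (induction A rule: infinite_finite_induct) auto
    moreover have "(if a + b = 1 then - 1 else 1) =
        (if a = 1 then - 1 else 1) * (if b = 1 then - 1 else (1::real))" for a b :: bit
      by (cases a; cases b) auto
    ultimately show ?thesis
      using A by (auto simp: characters_iff \<phi>_def V_eq prod.distrib[symmetric] subset_iff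
          intro!: prod.cong)
  qed
  moreover have "inj_on \<phi> (Pow {..<m})"
  proof (rule inj_onI)
    \<comment> \<open>Unit vectors recover \<open>A\<close> from its character, whence
      injectivity.\<close>
    have mem: "i \<in> A \<longleftrightarrow> \<phi> A (unit_vec m i) = -1" if "A \<subseteq> {..<m}" "i < m" for A i
    proof -
      have "\<phi> A (unit_vec m i) = (\<Prod>j\<in>A. if j = i then - 1 else 1)"
        using that by (auto simp: \<phi>_def V_eq unit_vec_def subset_iff intro!: prod.cong)
      also have "\<dots> = (if i \<in> A then -1 else 1)"
        using finite_subset[OF that(1)] by simp
      finally show ?thesis by simp
    qed
    fix A B assume "A \<in> Pow {..<m}" "B \<in> Pow {..<m}" "\<phi> A = \<phi> B"
    then show "A = B"
      using mem[of A] mem[of B] by auto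
  qed
  ultimately have "card (Pow {..<m}) \<le> card (characters m)"
    by (intro card_inj_on_le[where f = \<phi>] finite_characters) auto
  then show ?thesis by (simp add: card_Pow)
qed

text \<open>The product of the two characters is -1 at some \<open>a\<close>; translating by
  \<open>a\<close> permutes \<open>V m\<close> and negates the sum.\<close>

lemma sum_distinct_characters:
  assumes \<phi>: "\<phi> \<in> characters m" and \<psi>: "\<psi> \<in> characters m" and "\<phi> \<noteq> \<psi>"
  shows "(\<Sum>x\<in>V m. \<phi> x * \<psi> x) = 0"
proof -
  obtain a where a: "a \<in> V m" "\<phi> a \<noteq> \<psi> a"
    using assms by (metis characters_iff PiE_ext)
  then have neg: "\<phi> a * \<psi> a = -1"
    using character_sign[OF \<phi> a(1)] character_sign[OF \<psi> a(1)] by auto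
  have bb: "b + b = 0" for b :: bit
    by (cases b) auto
  \<comment> \<open>In characteristic 2 translation by \<open>a\<close> is its own inverse, so it
    serves as both witnesses of the reindexing.\<close>
  have aa: "a + (a + x) = x" if "x \<in> V m" for x
    using a(1) that unfolding V_eq by (intro eq_vecI) (auto simp: add.assoc[symmetric] bb)
  have "(\<Sum>x\<in>V m. \<phi> x * \<psi> x) = (\<Sum>x\<in>V m. \<phi> (a + x) * \<psi> (a + x))"
    using a(1) aa by (intro sum.reindex_bij_witness[of _ "\<lambda>x. a + x" "\<lambda>x. a + x"]) (auto simp: V_eq)
  also have "\<dots> = (\<Sum>x\<in>V m. (\<phi> a * \<psi> a) * (\<phi> x * \<psi> x))"
    using \<phi> \<psi> a(1) by (intro sum.cong) (auto simp: characters_iff)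
  also have "\<dots> = - (\<Sum>x\<in>V m. \<phi> x * \<psi> x)"
    by (simp add: neg sum_negf)
  finally show ?thesis by simp
qed

section \<open>Second moment method for the exponential moment\<close>

text \<open>Chebyshev's inequality for the lower tail in counting form: \<open>a\<close> is the mean
  and the right side is \<open>card \<Omega>\<close> times the variance.\<close>

lemma card_le_second_moment:
  fixes X :: "'a \<Rightarrow> real" and a b :: real
  assumes "finite \<Omega>" "b \<le> a" and mean: "(\<Sum>f\<in>\<Omega>. X f) = card \<Omega> * a"
  shows "card {f \<in> \<Omega>. X f \<le> b} * (a - b)\<^sup>2 \<le> (\<Sum>f\<in>\<Omega>. (X f)\<^sup>2) - card \<Omega> * a\<^sup>2"
proof -
  have "card {f \<in> \<Omega>. X f \<le> b} * (a - b)\<^sup>2 = (\<Sum>f\<in>{f \<in> \<Omega>. X f \<le> b}. (a - b)\<^sup>2)"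
    by simp
  also have "\<dots> \<le> (\<Sum>f\<in>{f \<in> \<Omega>. X f \<le> b}. (a - X f)\<^sup>2)"
    using assms(2) by (intro sum_mono power_mono) auto
  also have "\<dots> \<le> (\<Sum>f\<in>\<Omega>. (a - X f)\<^sup>2)"
    using assms(1) by (intro sum_mono2) auto
  also have "\<dots> = (\<Sum>f\<in>\<Omega>. a\<^sup>2 + (X f)\<^sup>2 - 2 * a * X f)"
    by (simp add: power2_diff)
  also have "\<dots> = (\<Sum>f\<in>\<Omega>. (X f)\<^sup>2) - card \<Omega> * a\<^sup>2"
    by (simp add: sum.distrib sum_subtractf sum_distrib_left[symmetric] mean power2_eq_square)
  finally show ?thesis .
qed

text \<open>The variable \<open>X\<close> of the overview, with \<open>t\<close> left free.\<close>

definition exp_moment :: "nat \<Rightarrow> real \<Rightarrow> (bit Matrix.vec \<Rightarrow> real) \<Rightarrow> real" where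
  "exp_moment m t f = (\<Sum>\<phi>\<in>characters m. exp (t * fourier m f \<phi>))"

text \<open>As \<open>cosh\<close> is even, the signs of a character drop out and all characters
  contribute equally.\<close>

lemma sum_exp_moment:
  "(\<Sum>f\<in>Omega m. exp_moment m t f) = 2 ^ 2 ^ m * (card (characters m) * cosh t ^ 2 ^ m)"
proof -
  have "(\<Prod>x\<in>V m. cosh (t * \<phi> x)) = cosh t ^ 2 ^ m" if "\<phi> \<in> characters m" for \<phi>
  proof -
    have "(\<Prod>x\<in>V m. cosh (t * \<phi> x)) = (\<Prod>x\<in>V m. cosh t)"
      using character_sign[OF that] by (intro prod.cong) fastforce+
    then show ?thesis by (simp add: card_V)
  qed
  then show ?thesis
    unfolding exp_moment_def fourier_def
    by (subst sum.swap) (simp add: sum_Omega_exp)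
qed

text \<open>Expanding the square gives pairs of characters. The \<open>N\<close> diagonal pairs
  account for \<open>c ^ 4\<close>; the others, by orthogonality, contribute at most
  \<open>c^2\<close> each, which adds up to no more than the squared mean.\<close>

lemma sum_exp_moment_square_le:
  fixes m :: nat and t :: real
  defines "N \<equiv> card (characters m)" and "c \<equiv> cosh t ^ 2 ^ m"
  shows "(\<Sum>f\<in>Omega m. (exp_moment m t f)\<^sup>2) \<le> 2 ^ 2 ^ m * (N * c ^ 4 + (N * c)\<^sup>2)"
proof -
  \<comment> \<open>Granting \<open>c^2\<close> to the diagonal pairs too makes the double sum split
    at once.\<close>
  have prod_le: "(\<Prod>x\<in>V m. cosh (t * (\<phi> x + \<psi> x))) \<le> (if \<phi> = \<psi> then c ^ 4 else 0) + c\<^sup>2"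
    if "\<phi> \<in> characters m" "\<psi> \<in> characters m" for \<phi> \<psi>
  proof (cases "\<phi> = \<psi>")
    case True
    have "(\<Prod>x\<in>V m. cosh (t * (\<phi> x + \<psi> x))) \<le> (\<Prod>x\<in>V m. cosh t ^ 4)"
      using that by (intro prod_mono conjI cosh_add_sign_le' character_sign) auto
    also have "\<dots> = c ^ 4"
      by (simp add: card_V c_def power_mult[symmetric] mult.commute)
    finally show ?thesis using True by (simp add: add_increasing2)
  next
    case False
    have "(\<Prod>x\<in>V m. cosh (t * (\<phi> x + \<psi> x)))
        \<le> (\<Prod>x\<in>V m. (cosh t)\<^sup>2 * exp (\<phi> x * \<psi> x * (tanh t)\<^sup>2))"
      using that by (intro prod_mono conjI cosh_add_sign_le character_sign) auto
    also have "\<dots> = c\<^sup>2 * exp ((\<Sum>x\<in>V m. \<phi> x * \<psi> x) * (tanh t)\<^sup>2)"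
      by (simp add: prod.distrib card_V c_def power_mult[symmetric] mult.commute
          sum_distrib_left exp_sum finite_V)
    also have "\<dots> = c\<^sup>2"
      by (simp add: sum_distinct_characters that False)
    finally show ?thesis using False by simp
  qed
  have "(\<Sum>f\<in>Omega m. (exp_moment m t f)\<^sup>2)
      = (\<Sum>f\<in>Omega m. \<Sum>\<phi>\<in>characters m. \<Sum>\<psi>\<in>characters m.
          exp (t * (\<Sum>x\<in>V m. f x * (\<phi> x + \<psi> x))))"
    by (simp add: exp_moment_def fourier_def power2_eq_square sum_product exp_add[symmetric]
        distrib_left sum.distrib)
  also have "\<dots> = (\<Sum>\<phi>\<in>characters m. \<Sum>\<psi>\<in>characters m. \<Sum>f\<in>Omega m.
          exp (t * (\<Sum>x\<in>V m. f x * (\<phi> x + \<psi> x))))"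
    by (rule trans[OF sum.swap], rule sum.cong[OF refl], rule sum.swap)
  also have "\<dots> \<le> (\<Sum>\<phi>\<in>characters m. \<Sum>\<psi>\<in>characters m.
          2 ^ 2 ^ m * ((if \<phi> = \<psi> then c ^ 4 else 0) + c\<^sup>2))"
    unfolding sum_Omega_exp by (intro sum_mono mult_left_mono prod_le) auto
  also have "\<dots> = 2 ^ 2 ^ m * (N * c ^ 4 + (N * c)\<^sup>2)"
    by (simp add: sum_distrib_left[symmetric] sum.distrib finite_characters N_def
        power2_eq_square algebra_simps)
  finally show ?thesis .
qed

text \<open>Chebyshev around the mean \<open>N * c\<close>: the deviation squared is of order
  \<open>N^2\<close>, the variance only of order \<open>N\<close>, and
  \<open>N \<ge> 2 ^ m\<close>.\<close>

lemma card_exp_moment_small: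
  fixes m :: nat and t :: real
  defines "N \<equiv> card (characters m)" and "c \<equiv> cosh t ^ 2 ^ m"
  assumes l: "l < 1"
  shows "card {f \<in> Omega m. exp_moment m t f \<le> l * (N * c)} / card (Omega m)
    \<le> c\<^sup>2 / (2 ^ m * (1 - l)\<^sup>2)"
proof -
  let ?k = "real (card {f \<in> Omega m. exp_moment m t f \<le> l * (N * c)})"
  have c: "c > 0" by (simp add: c_def)
  have "(2 ^ m :: real) \<le> N"
    unfolding N_def using card_characters_ge[of m] by (metis of_nat_le_iff of_nat_numeral of_nat_power)
  moreover have "(0 :: real) < 2 ^ m" by simp
  ultimately have N: "(2 ^ m :: real) \<le> N" "0 < real N" by linarith+
  have "?k * (N * c - l * (N * c))\<^sup>2
      \<le> (\<Sum>f\<in>Omega m. (exp_moment m t f)\<^sup>2) - card (Omega m) * (N * c)\<^sup>2"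
  proof (rule card_le_second_moment[OF finite_Omega])
    have "l * (N * c) \<le> 1 * (N * c)"
      using l c by (intro mult_right_mono) auto
    then show "l * (N * c) \<le> N * c" by simp
  qed (simp add: sum_exp_moment card_Omega N_def c_def)
  \<comment> \<open>The squared mean cancels, leaving only the diagonal contribution.\<close>
  also have "\<dots> \<le> card (Omega m) * (N * c ^ 4)"
    using sum_exp_moment_square_le[of m t] by (simp add: card_Omega N_def c_def algebra_simps)
  finally have "?k * (1 - l)\<^sup>2 * N * (N * c\<^sup>2) \<le> card (Omega m) * c\<^sup>2 * (N * c\<^sup>2)"
    by (simp add: power2_eq_square power4_eq_xxxx algebra_simps)
  then have "?k * (1 - l)\<^sup>2 * N \<le> card (Omega m) * c\<^sup>2"
    using N c by (subst (asm) mult_le_cancel_right) auto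
  moreover have "?k * (1 - l)\<^sup>2 * 2 ^ m \<le> ?k * (1 - l)\<^sup>2 * N"
    using N by (intro mult_left_mono) auto
  ultimately have "?k * (1 - l)\<^sup>2 * 2 ^ m \<le> card (Omega m) * c\<^sup>2"
    by linarith
  then have le: "?k * (2 ^ m * (1 - l)\<^sup>2) \<le> c\<^sup>2 * card (Omega m)"
    by (simp only: mult_ac)
  have "x / w \<le> y / p" if "0 < w" "0 < p" "x * p \<le> y * w" for x w y p :: real
    using that by (simp add: field_simps)
  from this[OF _ _ le] show ?thesis
    using l by (simp add: card_Omega)
qed

section \<open>From the exponential moment to the sup norm\<close>

lemma exp_moment_le:
  assumes "0 \<le> t" "fourier_sup_norm m f \<le> s"
  shows "exp_moment m t f \<le> card (characters m) * exp (t * s)"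
proof -
  have "fourier m f \<phi> \<le> s" if "\<phi> \<in> characters m" for \<phi>
  proof -
    have "\<bar>fourier m f \<phi>\<bar> \<le> fourier_sup_norm m f"
      unfolding fourier_sup_norm_def using that by (intro Max_ge) (auto simp: finite_characters)
    then show ?thesis using assms(2) by linarith
  qed
  then have "exp_moment m t f \<le> (\<Sum>\<phi>\<in>characters m. exp (t * s))"
    unfolding exp_moment_def using assms(1) by (intro sum_mono) (auto intro: mult_left_mono)
  then show ?thesis by simp
qed

theorem mainTheorem2:
  fixes \<alpha> \<eta> :: real
  assumes "0 < \<alpha>" and "\<alpha> < 1" and "0 < \<eta>" and "\<eta> < 1 - \<alpha>\<^sup>2"
  shows "\<exists>B::real. B > 0 \<and>
    (\<forall>m::nat. m > 0 \<longrightarrow>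
      (let q = (2::real) ^ m in
        prob_Omega m {f. fourier_sup_norm m f >
                 (\<alpha> / 2 - \<eta> / \<alpha> - \<alpha> ^ 3 * (ln q / q)) * sqrt (q * ln q)}
          > 1 - B / (q powr \<eta>)))"
proof -
  \<comment> \<open>Since \<open>q \<ge> 2\<close>, \<open>d\<close> bounds
    \<open>1 - q powr - \<eta>\<close> below for every \<open>m > 0\<close>, which makes the
    constant uniform in \<open>m\<close>.\<close>
  define d where "d = 1 - (2::real) powr - \<eta>"
  have d: "d > 0"
    using assms(3) by (simp add: d_def powr_less_one)
  \<comment> \<open>The estimate yields \<open>1 / d^2\<close>; the factor 2 makes the inequality
    strict.\<close>
  have "prob_Omega m {f. fourier_sup_norm m f >
            (\<alpha> / 2 - \<eta> / \<alpha> - \<alpha> ^ 3 * (ln q / q)) * sqrt (q * ln q)}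
          > 1 - (2 / d\<^sup>2) / (q powr \<eta>)"
    if m: "m > 0" and q_def: "q = (2::real) ^ m" for m q
  proof -
    define t where "t = \<alpha> * sqrt (ln q / q)"
    define s where "s = (\<alpha> / 2 - \<eta> / \<alpha> - \<alpha> ^ 3 * (ln q / q)) * sqrt (q * ln q)"
    define l where "l = q powr - \<eta>"
    define c where "c = cosh t ^ 2 ^ m"
    define N where "N = card (characters m)"
    define bad where "bad = {f \<in> Omega m. fourier_sup_norm m f \<le> s}"
    have q: "2 \<le> q" unfolding q_def using m by (simp add: self_le_power)
    then have lnq: "0 < ln q" by simp
    have t: "0 \<le> t" using assms(1) q lnq by (simp add: t_def)
    have l1: "1 - l \<ge> d"
      unfolding d_def l_def using q assms(3) by (simp add: powr_mono2')
    have t2: "q * t\<^sup>2 = \<alpha>\<^sup>2 * ln q"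
      using q lnq by (simp add: t_def power_mult_distrib)
    have "t ^ 4 = (t\<^sup>2)\<^sup>2" by (simp flip: power_mult)
    also have "t\<^sup>2 = \<alpha>\<^sup>2 * ln q / q" using t2 q by (simp add: field_simps)
    finally have t4: "q * t ^ 4 = \<alpha> ^ 4 * (ln q)\<^sup>2 / q"
      using q by (simp add: field_simps power2_eq_square power4_eq_xxxx)
    have "sqrt (ln q / q) * sqrt (q * ln q) = sqrt ((ln q)\<^sup>2)"
      using q by (simp add: real_sqrt_mult[symmetric] power2_eq_square)
    then have "sqrt (ln q / q) * sqrt (q * ln q) = ln q"
      using lnq by simp
    then have "t * s = \<alpha> * (\<alpha> / 2 - \<eta> / \<alpha> - \<alpha> ^ 3 * (ln q / q)) * ln q"
      by (simp add: t_def s_def mult_ac)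
    \<comment> \<open>By \<open>t2\<close> and \<open>t4\<close>, the three terms of
      \<open>s\<close> become \<open>q * t^2 / 2\<close>, the exponent of \<open>l\<close>, and the
      error \<open>q * t ^ 4\<close> of \<open>exp_le_cosh\<close>.\<close>
    also have "\<dots> = - \<eta> * ln q + q * (t\<^sup>2 / 2 - t ^ 4)"
      using assms(1) q t2 t4 by (simp add: right_diff_distrib) (simp add: field_simps power2_eq_square power3_eq_cube power4_eq_xxxx)
    finally have "exp (t * s) = exp (- \<eta> * ln q) * exp (q * (t\<^sup>2 / 2 - t ^ 4))"
      by (simp only: exp_add)
    then have "exp (t * s) = l * exp (t\<^sup>2 / 2 - t ^ 4) ^ 2 ^ m"
      using q by (simp add: l_def powr_def exp_of_nat_mult[symmetric]) (simp add: q_def)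
    also have "\<dots> \<le> l * c"
      unfolding c_def l_def by (intro mult_left_mono power_mono exp_le_cosh) auto
    finally have ts: "exp (t * s) \<le> l * c" .
    \<comment> \<open>A small sup norm forces the exponential moment below the fraction
      \<open>l\<close> of its mean.\<close>
    have "bad \<subseteq> {f \<in> Omega m. exp_moment m t f \<le> l * (N * c)}"
    proof
      fix f assume f: "f \<in> bad"
      then have "exp_moment m t f \<le> N * exp (t * s)"
        unfolding bad_def N_def by (intro exp_moment_le t) auto
      also have "\<dots> \<le> N * (l * c)"
        by (intro mult_left_mono ts) auto
      finally show "f \<in> {f \<in> Omega m. exp_moment m t f \<le> l * (N * c)}"
        using f by (simp add: bad_def mult_ac)
    qed
    then have "card bad / card (Omega m)
        \<le> card {f \<in> Omega m. exp_moment m t f \<le> l * (N * c)} / card (Omega m)"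
      by (intro divide_right_mono of_nat_mono card_mono) (auto simp: finite_Omega)
    also have "\<dots> \<le> c\<^sup>2 / (q * (1 - l)\<^sup>2)"
      unfolding N_def c_def q_def using l1 d by (intro card_exp_moment_small) auto
    also have "\<dots> \<le> (q powr \<alpha>\<^sup>2) / (q * d\<^sup>2)"
    proof (rule frac_le)
      have "c \<le> exp (t\<^sup>2 / 2) ^ 2 ^ m"
        unfolding c_def by (intro power_mono cosh_le_exp_half_square) auto
      then have "c\<^sup>2 \<le> (exp (t\<^sup>2 / 2) ^ 2 ^ m)\<^sup>2"
        by (intro power_mono) (auto simp: c_def)
      also have "\<dots> = exp (q * t\<^sup>2)"
        by (simp add: exp_of_nat_mult[symmetric] q_def exp_double[symmetric])
      also have "\<dots> = q powr \<alpha>\<^sup>2"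
        using q by (simp add: t2 powr_def)
      finally show "c\<^sup>2 \<le> q powr \<alpha>\<^sup>2" .
      show "q * d\<^sup>2 \<le> q * (1 - l)\<^sup>2"
        using q l1 d by (intro mult_left_mono power_mono) auto
    qed (use q d in auto)
    also have "\<dots> = q powr (\<alpha>\<^sup>2 - 1) / d\<^sup>2"
      using q by (simp add: powr_diff)
    \<comment> \<open>The hypothesis \<open>\<eta> < 1 - \<alpha>^2\<close> enters here, to compare
      the exponents.\<close>
    also have "\<dots> \<le> q powr - \<eta> / d\<^sup>2"
      using q assms(4) by (intro divide_right_mono powr_mono) auto
    also have "\<dots> < (2 / d\<^sup>2) / (q powr \<eta>)"
      using q d by (simp add: powr_minus field_simps)
    finally have bad: "card bad / card (Omega m) < (2 / d\<^sup>2) / (q powr \<eta>)" .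
    have "{f \<in> Omega m. fourier_sup_norm m f > s} = Omega m - bad"
      by (auto simp: bad_def)
    then have "real (card {f \<in> Omega m. fourier_sup_norm m f > s}) = card (Omega m) - real (card bad)"
      using card_Diff_subset[of bad "Omega m"] card_mono[of "Omega m" bad]
      by (simp add: bad_def finite_Omega of_nat_diff)
    then have "prob_Omega m {f. fourier_sup_norm m f > s} = 1 - card bad / card (Omega m)"
      by (simp add: prob_Omega_eq_card diff_divide_distrib card_Omega)
    then show ?thesis
      using bad by (simp add: s_def)
  qed
  moreover have "2 / d\<^sup>2 > 0" using d by simp
  ultimately show ?thesis
    unfolding Let_def by blast
qed

end
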